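(* Let $G=\mathbb{R}^d\rtimes K$, $X=\mathbb{R}^d$, $\Xi$, $\mathrm{d}\xi$, $m_0$, $\sigma$, $\mathcal{A}$, the representations $\pi$ on $L^2(X,\mathrm{d}x)$ and $\hat\pi$ on $L^2(\Xi,\mathrm{d}\xi)$, the character $\chi$, the closed Radon transform $\overline{\mathcal{R}}$, and the operators $\mathcal{I}$ and $\mathcal{Q}$ be as described in the context, satisfying all the standing assumptions listed there. Let $\psi\in L^2(X,\mathrm{d}x)$ be an admissible vector for $\pi$ such that $\mathcal{Q}\psi\in\operatorname{dom}\mathcal{I}$, and set $\Psi=\mathcal{I}\mathcal{Q}\psi$. Then, for any $f\in\operatorname{dom}\overline{\mathcal{R}}$, $$f=\int_G\chi(g)\,\langle\overline{\mathcal{R}}f,\hat\pi(g)\Psi\rangle\,\pi(g)\psi\;\mathrm{d}\mu(g),$$ where the integral is weakly convergent, and $$\|f\|^2=\int_G\chi(g)^2\,|\langle\overline{\mathcal{R}}f,\hat\pi(g)\Psi\rangle|^2\,\mathrm{d}\mu(g).$$ If, in addition, $\psi\in\operatorname{dom}\overline{\mathcal{R}}$, then $\Psi=\mathcal{I}^2\,\overline{\mathcal{R}}\psi$.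
   Context: **Group and spaces.** $K$ is a closed subgroup of $\mathrm{GL}(d,\mathbb{R})$ and $G=\mathbb{R}^d\rtimes K$ is the Lie group with product $(b_1,k_1)(b_2,k_2)=(b_1+k_1b_2,k_1k_2)$ and neutral element $e$; $\mu$ is the left Haar measure $\mathrm{d}\mu(b,k)=|\det k|^{-1}\mathrm{d}b\,\mathrm{d}k$, with $\mathrm{d}b$ Lebesgue measure and $\mathrm{d}k$ a left Haar measure on $K$. $X=\mathbb{R}^d$ is the transitive $G$-space with action $(b,k)[x]=b+kx$, origin $x_0=0$ (whose isotropy is $\{(0,k):k\in K\}\simeq K$), and Lebesgue measure $\mathrm{d}x$. $\Xi$ is a smooth transitive $G$-space, with action written $g.\xi$, a fixed origin $\xi_0\in\Xi$, and $H\subseteq G$ the isotropy subgroup at $\xi_0$. Put $\hat\xi_0=H[x_0]\subset X$ and $\check x_0=K.\xi_0\subset\Xi$. A positive character of a group is a continuous homomorphism into $(0,+\infty)$. A Borel section $\sigma:\Xi\to G$ is a measurable map with $\sigma(\xi).\xi_0=\xi$ for all $\xi\in\Xi$ and $\sigma(\xi_0)=e$. **Standing assumptions** (measures are nonzero). - $\Xi$ carries a relatively $G$-invariant measure $\mathrm{d}\xi$: there is a positive character $\beta$ of $G$ with $\int_\Xi f(g^{-1}.\xi)\,\mathrm{d}\xi=\beta(g)\int_\Xi f(\xi)\,\mathrm{d}\xi$ for $f\in L^1(\Xi,\mathrm{d}\xi)$, $g\in G$. - The $H$-transitive space $\hat\xi_0$ carries a relatively $H$-invariant Radon measure $m_0$: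 there is a positive character $\gamma$ of $H$ with $\int_{\hat\xi_0}f(h^{-1}[x])\,\mathrm{d}m_0(x)=\gamma(h)\int_{\hat\xi_0}f(x)\,\mathrm{d}m_0(x)$ for $f\in L^1(\hat\xi_0,m_0)$, $h\in H$. - $\sigma:\Xi\to G$ is a Borel section such that $\gamma(\sigma(\xi)^{-1}g\,\sigma(g^{-1}.\xi))$ (where $\sigma(\xi)^{-1}g\,\sigma(g^{-1}.\xi)\in H$) does not depend on $\xi$ and is a positive character of $G$ as a function of $g$. - $(X,\Xi)$ is a dual pair: with $\hat\xi=\sigma(\xi)[\hat\xi_0]\subset X$ and $\check x=(x,\mathrm{I}_d).\check x_0\subset\Xi$, the maps $\xi\mapsto\hat\xi$ and $x\mapsto\check x$ are both injective. - The quasi-regular representation $\pi$ of $G$ on $L^2(X,\mathrm{d}x)$, $\pi(b,k)f(x)=|\det k|^{-1/2}f(k^{-1}(x-b))$, is irreducible and square-integrable. - The quasi-regular representation $\hat\pi$ of $G$ on $L^2(\Xi,\mathrm{d}\xi)$, $\hat\pi(g)F(\xi)=\beta(g)^{-1/2}F(g^{-1}.\xi)$, is irreducible. - $\mathcal{A}\subseteq L^2(X,\mathrm{d}x)$ is a non-trivial $\pi$-invariant linear subspace such that for every $f\in\mathcal{A}$ one has $f(\sigma(\xi)[\cdot])\in L^1(\hat\xi_0,m_0)$ for almost all $\xi\in\Xi$, the function (Radon transform of $f$) $$\mathcal{R}f(\xi)=\int_{\hat\xi_0}f(\sigma(\xi)[x])\,\mathrm{d}m_0(x)$$ belongs to $L^2(\Xi,\mathrm{d}\xi)$,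 and $f\mapsto\mathcal{R}f$ is a closable operator from $\mathcal{A}$ to $L^2(\Xi,\mathrm{d}\xi)$. Its closure is denoted $\overline{\mathcal{R}}$. **Weight.** $\chi(g)=\beta(g)^{-1/2}\,|\det k|^{1/2}\,\gamma\bigl(g\,\sigma(g^{-1}.\xi_0)\bigr)^{-1}$ for $g=(b,k)\in G$; it is a positive character of $G$. **The operators $\mathcal{I}$ and $\mathcal{Q}$.** $\mathcal{I}$ is the (unique) positive self-adjoint operator in $L^2(\Xi,\mathrm{d}\xi)$ with $\operatorname{dom}(\mathcal{I})\supseteq\operatorname{Im}\overline{\mathcal{R}}$, semi-invariant with weight $\chi^{-1}$ (that is, $\hat\pi(g)\mathcal{I}\hat\pi(g)^{-1}=\chi(g)^{-1}\mathcal{I}$ for all $g\in G$), such that $\mathcal{I}\,\overline{\mathcal{R}}$ extends to an isometry $\mathcal{Q}:L^2(X,\mathrm{d}x)\to L^2(\Xi,\mathrm{d}\xi)$ with $\hat\pi(g)\mathcal{Q}\pi(g)^{-1}=\mathcal{Q}$ for all $g\in G$; under the assumptions above such $\mathcal{I}$ exists and $\mathcal{Q}$ is unitary. **Admissible vectors.** Since $\pi$ is square-integrable, there is a self-adjoint operator $C$ in $L^2(X,\mathrm{d}x)$, semi-invariant with weight $\Delta^{1/2}$ ($\Delta$ the modular function of $G$), such that for every $\psi\in\operatorname{dom}C$ with $\|C\psi\|=1$ the voice transform $(\mathcal{V}_\psi f)(g)=\langle f,\pi(g)\psi\rangle$ is an isometry from $L^2(X,\mathrm{d}x)$ into $L^2(G,\mu)$;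 such a $\psi$ is called an admissible vector. Equivalently, $\psi$ is admissible if $\mathcal{V}_\psi$ is an isometry from $L^2(X,\mathrm{d}x)$ into $L^2(G,\mu)$. Scalar products are linear in the first entry. Weak convergence of $f=\int_G c(g)\,\pi(g)\psi\,\mathrm{d}\mu(g)$ means $\langle f,h\rangle=\int_G c(g)\langle\pi(g)\psi,h\rangle\,\mathrm{d}\mu(g)$ for all $h\in L^2(X,\mathrm{d}x)$. *)

theory Defs
  imports "HOL-Analysis.Analysis"
begin

section \<open>The group \<open>\<real>\<^sup>d \<rtimes> K\<close>\<close>

type_synonym 'd aff = "(real^'d) \<times> (real^'d^'d)"

definition sd_mult :: "'d::finite aff \<Rightarrow> 'd aff \<Rightarrow> 'd aff" where
  "sd_mult g h = (fst g + snd g *v fst h, snd g ** snd h)"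

definition sd_one :: "'d::finite aff" where
  "sd_one = (0, mat 1)"

definition sd_inv :: "'d::finite aff \<Rightarrow> 'd aff" where
  "sd_inv g = (- (matrix_inv (snd g) *v fst g), matrix_inv (snd g))"

definition sd_act :: "'d::finite aff \<Rightarrow> real^'d \<Rightarrow> real^'d" where
  "sd_act g x = fst g + snd g *v x"

definition semidirect :: "(real^'d::finite^'d) set \<Rightarrow> 'd aff set" where
  "semidirect K = UNIV \<times> K"

definition closed_subgroup_GL :: "(real^'d::finite^'d) set \<Rightarrow> bool" where
  "closed_subgroup_GL K \<longleftrightarrow>
     K \<subseteq> {A. invertible A} \<and> closedin (top_of_set {A. invertible A}) K \<and> mat 1 \<in> K \<and>
     (\<forall>k\<in>K. \<forall>l\<in>K. k ** l \<in> K) \<and> (\<forall>k\<in>K. matrix_inv k \<in> K)"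

text \<open>\<open>K\<close> is locally compact and second countable, so that a Borel measure on it which is finite on
  compact sets is automatically regular.\<close>

definition left_haar :: "(real^'d::finite^'d) set \<Rightarrow> (real^'d^'d) measure \<Rightarrow> bool" where
  "left_haar K \<kappa> \<longleftrightarrow>
     sets \<kappa> = sets (restrict_space borel K) \<and> emeasure \<kappa> (space \<kappa>) \<noteq> 0 \<and>
     (\<forall>C. compact C \<and> C \<subseteq> K \<longrightarrow> emeasure \<kappa> C < \<infinity>) \<and>
     (\<forall>k\<in>K. \<forall>B\<in>sets \<kappa>. emeasure \<kappa> ((\<lambda>l. k ** l) ` B) = emeasure \<kappa> B)"

definition sd_haar :: "(real^'d::finite^'d) measure \<Rightarrow> 'd aff measure" where
  "sd_haar \<kappa> = density (lborel \<Otimes>\<^sub>M \<kappa>) (\<lambda>(b, k). ennreal (1 / \<bar>det k\<bar>))"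

definition pos_character :: "'d::finite aff set \<Rightarrow> ('d aff \<Rightarrow> real) \<Rightarrow> bool" where
  "pos_character S c \<longleftrightarrow>
     continuous_on S c \<and> (\<forall>g\<in>S. 0 < c g) \<and> (\<forall>g\<in>S. \<forall>h\<in>S. c (sd_mult g h) = c g * c h)"


section \<open>Smooth transitive spaces\<close>

primrec Ck_on :: "nat \<Rightarrow> 'a::euclidean_space set \<Rightarrow> ('a \<Rightarrow> 'b::euclidean_space) \<Rightarrow> bool" where
  "Ck_on 0 S f \<longleftrightarrow> continuous_on S f"
| "Ck_on (Suc n) S f \<longleftrightarrow>
     (\<forall>x\<in>S. f differentiable (at x)) \<and> (\<forall>v. Ck_on n S (\<lambda>x. frechet_derivative f (at x) v))"

text \<open>Smoothness on an arbitrary subset: locally the restriction of a smooth map defined on an open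
  subset of the ambient space.  On an embedded submanifold (a linear subspace, or the closed
  subgroup \<open>\<real>\<^sup>d \<rtimes> K\<close> of the affine group) this is smoothness in the sense of manifolds.\<close>

definition smooth_on :: "'a::euclidean_space set \<Rightarrow> ('a \<Rightarrow> 'b::euclidean_space) \<Rightarrow> bool" where
  "smooth_on S f \<longleftrightarrow>
     (\<forall>x\<in>S. \<exists>U F. open U \<and> x \<in> U \<and> (\<forall>n. Ck_on n U F) \<and> (\<forall>y\<in>S \<inter> U. F y = f y))"

text \<open>The model space of the charts is a linear subspace \<open>E\<close> of a Euclidean space rather than the
  whole Euclidean space, so that dimension zero is not excluded.\<close>

definition smooth_atlas ::
  "'e::euclidean_space set \<Rightarrow> ('x::topological_space set \<times> ('x \<Rightarrow> 'e)) set \<Rightarrow> bool" where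
  "smooth_atlas E \<A> \<longleftrightarrow>
     subspace E \<and> (\<Union>(U, \<phi>)\<in>\<A>. U) = UNIV \<and>
     (\<forall>(U, \<phi>)\<in>\<A>. open U \<and> openin (top_of_set E) (\<phi> ` U) \<and>
                  homeomorphism U (\<phi> ` U) \<phi> (inv_into U \<phi>)) \<and>
     (\<forall>(U, \<phi>)\<in>\<A>. \<forall>(W, \<theta>)\<in>\<A>. smooth_on (\<phi> ` (U \<inter> W)) (\<lambda>u. \<theta> (inv_into U \<phi> u)))"

definition smooth_transitive_space ::
  "'d::finite aff set \<Rightarrow> 'e::euclidean_space set \<Rightarrow> ('x::topological_space set \<times> ('x \<Rightarrow> 'e)) set \<Rightarrow>
   ('d aff \<Rightarrow> 'x \<Rightarrow> 'x) \<Rightarrow> bool" where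
  "smooth_transitive_space G E \<A> act \<longleftrightarrow>
     smooth_atlas E \<A> \<and>
     (\<forall>\<xi>. act sd_one \<xi> = \<xi>) \<and>
     (\<forall>g\<in>G. \<forall>h\<in>G. \<forall>\<xi>. act (sd_mult g h) \<xi> = act g (act h \<xi>)) \<and>
     (\<forall>\<xi> \<eta>. \<exists>g\<in>G. act g \<xi> = \<eta>) \<and>
     continuous_on (G \<times> UNIV) (\<lambda>(g, \<xi>). act g \<xi>) \<and>
     (\<forall>(U, \<phi>)\<in>\<A>. \<forall>(W, \<theta>)\<in>\<A>.
        smooth_on {(g, u). g \<in> G \<and> u \<in> \<phi> ` U \<and> act g (inv_into U \<phi> u) \<in> W}
                  (\<lambda>(g, u). \<theta> (act g (inv_into U \<phi> u))))"

definition isotropy :: "'d::finite aff set \<Rightarrow> ('d aff \<Rightarrow> 'x \<Rightarrow> 'x) \<Rightarrow> 'x \<Rightarrow> 'd aff set" where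
  "isotropy G act \<xi>0 = {g \<in> G. act g \<xi>0 = \<xi>0}"

definition hat_origin :: "'d::finite aff set \<Rightarrow> (real^'d) set" where
  "hat_origin H = (\<lambda>h. sd_act h 0) ` H"

definition check_origin ::
  "(real^'d::finite^'d) set \<Rightarrow> ('d aff \<Rightarrow> 'x \<Rightarrow> 'x) \<Rightarrow> 'x \<Rightarrow> 'x set" where
  "check_origin K act \<xi>0 = (\<lambda>k. act (0, k) \<xi>0) ` K"

definition borel_section ::
  "'d::finite aff set \<Rightarrow> ('d aff \<Rightarrow> 'x::topological_space \<Rightarrow> 'x) \<Rightarrow> 'x \<Rightarrow> ('x \<Rightarrow> 'd aff) \<Rightarrow> bool" where
  "borel_section G act \<xi>0 \<sigma> \<longleftrightarrow>
     \<sigma> \<in> borel_measurable borel \<and> (\<forall>\<xi>. \<sigma> \<xi> \<in> G \<and> act (\<sigma> \<xi>) \<xi>0 = \<xi>) \<and> \<sigma> \<xi>0 = sd_one"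

definition section_cocycle ::
  "('d::finite aff \<Rightarrow> 'x \<Rightarrow> 'x) \<Rightarrow> ('x \<Rightarrow> 'd aff) \<Rightarrow> 'd aff \<Rightarrow> 'x \<Rightarrow> 'd aff" where
  "section_cocycle act \<sigma> g \<xi> = sd_mult (sd_mult (sd_inv (\<sigma> \<xi>)) g) (\<sigma> (act (sd_inv g) \<xi>))"

definition dual_pair ::
  "(real^'d::finite^'d) set \<Rightarrow> ('d aff \<Rightarrow> 'x \<Rightarrow> 'x) \<Rightarrow> 'x \<Rightarrow> ('x \<Rightarrow> 'd aff) \<Rightarrow> bool" where
  "dual_pair K act \<xi>0 \<sigma> \<longleftrightarrow>
     inj (\<lambda>\<xi>. sd_act (\<sigma> \<xi>) ` hat_origin (isotropy (semidirect K) act \<xi>0)) \<and>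
     inj (\<lambda>x. act (x, mat 1) ` check_origin K act \<xi>0)"

definition rel_invariant ::
  "'y measure \<Rightarrow> 'd::finite aff set \<Rightarrow> ('d aff \<Rightarrow> 'y \<Rightarrow> 'y) \<Rightarrow> ('d aff \<Rightarrow> real) \<Rightarrow> bool" where
  "rel_invariant M S act c \<longleftrightarrow>
     pos_character S c \<and>
     (\<forall>g\<in>S. \<forall>f :: 'y \<Rightarrow> complex. integrable M f \<longrightarrow>
        has_bochner_integral M (\<lambda>y. f (act (sd_inv g) y)) (complex_of_real (c g) * (LINT y|M. f y)))"

text \<open>The orbit \<open>H[0]\<close> is regarded as the homogeneous space \<open>H / (H \<inter> K)\<close>, which is locally compact
  and second countable and has the same Borel sets as the subset \<open>H[0]\<close> of \<open>\<real>\<^sup>d\<close>.  A Borel measure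
  on it is Radon iff it is finite on compact sets; every compact set of \<open>H / (H \<inter> K)\<close> lies in the
  image of a compact subset of \<open>H\<close>, and such images are also compact in \<open>\<real>\<^sup>d\<close>.\<close>

definition radon_on_orbit :: "'d::finite aff set \<Rightarrow> (real^'d) measure \<Rightarrow> bool" where
  "radon_on_orbit H m0 \<longleftrightarrow>
     sets m0 = sets (restrict_space borel (hat_origin H)) \<and>
     (\<forall>C. compact C \<and> C \<subseteq> H \<longrightarrow> emeasure m0 (hat_origin C) < \<infinity>)"


section \<open>\<open>L\<^sup>2\<close> spaces and unbounded operators\<close>

text \<open>Vectors of \<open>L\<^sup>2(M)\<close> are represented by square-integrable functions, and equality in \<open>L\<^sup>2(M)\<close> is
  equality almost everywhere.  Accordingly, subspaces are sets of functions saturated with respect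
  to equality almost everywhere, and a (not necessarily bounded) linear operator with its domain is
  given by its graph, saturated in the same sense and single-valued up to equality almost
  everywhere.  Composition is relational composition; \<open>R O T\<close> is the operator \<open>T R\<close>.\<close>

definition l2_space :: "'a measure \<Rightarrow> ('a \<Rightarrow> complex) set" where
  "l2_space M = {f \<in> borel_measurable M. integrable M (\<lambda>x. (cmod (f x))\<^sup>2)}"

definition l2_eq :: "'a measure \<Rightarrow> ('a \<Rightarrow> complex) \<Rightarrow> ('a \<Rightarrow> complex) \<Rightarrow> bool" where
  "l2_eq M f g \<longleftrightarrow> (AE x in M. f x = g x)"

definition l2_inner :: "'a measure \<Rightarrow> ('a \<Rightarrow> complex) \<Rightarrow> ('a \<Rightarrow> complex) \<Rightarrow> complex" where
  "l2_inner M f g = (LINT x|M. f x * cnj (g x))"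

definition l2_norm :: "'a measure \<Rightarrow> ('a \<Rightarrow> complex) \<Rightarrow> real" where
  "l2_norm M f = sqrt (LINT x|M. (cmod (f x))\<^sup>2)"

definition l2_tendsto :: "'a measure \<Rightarrow> (nat \<Rightarrow> 'a \<Rightarrow> complex) \<Rightarrow> ('a \<Rightarrow> complex) \<Rightarrow> bool" where
  "l2_tendsto M fs f \<longleftrightarrow> (\<lambda>n. l2_norm M (\<lambda>x. fs n x - f x)) \<longlonglongrightarrow> 0"

definition l2_subspace :: "'a measure \<Rightarrow> ('a \<Rightarrow> complex) set \<Rightarrow> bool" where
  "l2_subspace M V \<longleftrightarrow>
     V \<subseteq> l2_space M \<and> (\<lambda>_. 0) \<in> V \<and>
     (\<forall>f\<in>V. \<forall>g\<in>l2_space M. l2_eq M f g \<longrightarrow> g \<in> V) \<and>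
     (\<forall>f\<in>V. \<forall>g\<in>V. (\<lambda>x. f x + g x) \<in> V) \<and>
     (\<forall>a. \<forall>f\<in>V. (\<lambda>x. a * f x) \<in> V)"

definition l2_closed_subspace :: "'a measure \<Rightarrow> ('a \<Rightarrow> complex) set \<Rightarrow> bool" where
  "l2_closed_subspace M V \<longleftrightarrow>
     l2_subspace M V \<and>
     (\<forall>fs. \<forall>f\<in>l2_space M. range fs \<subseteq> V \<and> l2_tendsto M fs f \<longrightarrow> f \<in> V)"

type_synonym ('a, 'b) l2_op = "(('a \<Rightarrow> complex) \<times> ('b \<Rightarrow> complex)) set"

definition l2_operator :: "'a measure \<Rightarrow> 'b measure \<Rightarrow> ('a, 'b) l2_op \<Rightarrow> bool" where
  "l2_operator M N T \<longleftrightarrow>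
     T \<subseteq> l2_space M \<times> l2_space N \<and> (\<lambda>_. 0, \<lambda>_. 0) \<in> T \<and>
     (\<forall>(f, F)\<in>T. \<forall>f'\<in>l2_space M. \<forall>F'\<in>l2_space N.
        l2_eq M f f' \<and> l2_eq N F F' \<longrightarrow> (f', F') \<in> T) \<and>
     (\<forall>(f, F)\<in>T. \<forall>(f', F')\<in>T. (\<lambda>x. f x + f' x, \<lambda>y. F y + F' y) \<in> T) \<and>
     (\<forall>a. \<forall>(f, F)\<in>T. (\<lambda>x. a * f x, \<lambda>y. a * F y) \<in> T) \<and>
     (\<forall>(f, F)\<in>T. \<forall>(f', F')\<in>T. l2_eq M f f' \<longrightarrow> l2_eq N F F')"

definition l2_op_closure ::
  "'a measure \<Rightarrow> 'b measure \<Rightarrow> ('a, 'b) l2_op \<Rightarrow> ('a, 'b) l2_op" where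
  "l2_op_closure M N T =
     {(f, F). f \<in> l2_space M \<and> F \<in> l2_space N \<and>
        (\<exists>fs Fs. (\<forall>n. (fs n, Fs n) \<in> T) \<and> l2_tendsto M fs f \<and> l2_tendsto N Fs F)}"

definition l2_closable :: "'a measure \<Rightarrow> 'b measure \<Rightarrow> ('a, 'b) l2_op \<Rightarrow> bool" where
  "l2_closable M N T \<longleftrightarrow> (\<forall>F. (\<lambda>_. 0, F) \<in> l2_op_closure M N T \<longrightarrow> l2_eq N F (\<lambda>_. 0))"

definition l2_adjoint ::
  "'a measure \<Rightarrow> 'b measure \<Rightarrow> ('a, 'b) l2_op \<Rightarrow> ('b, 'a) l2_op" where
  "l2_adjoint M N T =
     {(u, v). u \<in> l2_space N \<and> v \<in> l2_space M \<and>
        (\<forall>(f, F)\<in>T. l2_inner N F u = l2_inner M f v)}"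

definition l2_self_adjoint :: "'a measure \<Rightarrow> ('a, 'a) l2_op \<Rightarrow> bool" where
  "l2_self_adjoint M T \<longleftrightarrow>
     l2_operator M M T \<and>
     (\<forall>f\<in>l2_space M. \<exists>fs. range fs \<subseteq> Domain T \<and> l2_tendsto M fs f) \<and>
     l2_adjoint M M T = T"

definition l2_positive :: "'a measure \<Rightarrow> ('a, 'a) l2_op \<Rightarrow> bool" where
  "l2_positive M T \<longleftrightarrow>
     (\<forall>(f, F)\<in>T. Im (l2_inner M F f) = 0 \<and> 0 \<le> Re (l2_inner M F f))"

definition l2_isometry :: "'a measure \<Rightarrow> 'b measure \<Rightarrow> ('a, 'b) l2_op \<Rightarrow> bool" where
  "l2_isometry M N T \<longleftrightarrow>
     l2_operator M N T \<and> Domain T = l2_space M \<and> (\<forall>(f, F)\<in>T. l2_norm N F = l2_norm M f)"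

text \<open>For bijective \<open>a\<close>, \<open>op_conj a b T\<close> is the graph of \<open>b T a\<^sup>-\<^sup>1\<close>.\<close>

definition op_conj ::
  "(('a \<Rightarrow> complex) \<Rightarrow> 'a \<Rightarrow> complex) \<Rightarrow> (('b \<Rightarrow> complex) \<Rightarrow> 'b \<Rightarrow> complex) \<Rightarrow>
   ('a, 'b) l2_op \<Rightarrow> ('a, 'b) l2_op" where
  "op_conj a b T = (\<lambda>(f, F). (a f, b F)) ` T"

definition op_scale :: "complex \<Rightarrow> ('a, 'b) l2_op \<Rightarrow> ('a, 'b) l2_op" where
  "op_scale c T = (\<lambda>(f, F). (f, \<lambda>y. c * F y)) ` T"

definition has_weak_integral ::
  "'a measure \<Rightarrow> 'g measure \<Rightarrow> ('g \<Rightarrow> complex) \<Rightarrow> ('g \<Rightarrow> 'a \<Rightarrow> complex) \<Rightarrow> ('a \<Rightarrow> complex) \<Rightarrow> bool" where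
  "has_weak_integral M \<mu> c u f \<longleftrightarrow>
     (\<forall>h\<in>l2_space M. has_bochner_integral \<mu> (\<lambda>g. c g * l2_inner M (u g) h) (l2_inner M f h))"


section \<open>Representations\<close>

definition irreducible_rep ::
  "'a measure \<Rightarrow> 'g set \<Rightarrow> ('g \<Rightarrow> ('a \<Rightarrow> complex) \<Rightarrow> 'a \<Rightarrow> complex) \<Rightarrow> bool" where
  "irreducible_rep M G \<rho> \<longleftrightarrow>
     (\<exists>f\<in>l2_space M. \<not> l2_eq M f (\<lambda>_. 0)) \<and>
     (\<forall>V. l2_closed_subspace M V \<and> (\<forall>g\<in>G. \<forall>f\<in>V. \<rho> g f \<in> V) \<longrightarrow>
        V = {f \<in> l2_space M. l2_eq M f (\<lambda>_. 0)} \<or> V = l2_space M)"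

definition voice ::
  "'a measure \<Rightarrow> ('g \<Rightarrow> ('a \<Rightarrow> complex) \<Rightarrow> 'a \<Rightarrow> complex) \<Rightarrow> ('a \<Rightarrow> complex) \<Rightarrow> ('a \<Rightarrow> complex) \<Rightarrow>
   'g \<Rightarrow> complex" where
  "voice M \<rho> \<psi> f g = l2_inner M f (\<rho> g \<psi>)"

definition square_integrable_rep ::
  "'a measure \<Rightarrow> 'g measure \<Rightarrow> ('g \<Rightarrow> ('a \<Rightarrow> complex) \<Rightarrow> 'a \<Rightarrow> complex) \<Rightarrow> bool" where
  "square_integrable_rep M \<mu> \<rho> \<longleftrightarrow>
     (\<exists>\<psi>\<in>l2_space M. \<not> l2_eq M \<psi> (\<lambda>_. 0) \<and> voice M \<rho> \<psi> \<psi> \<in> l2_space \<mu>)"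

text \<open>The voice transform \<open>f \<mapsto> voice M \<rho> \<psi> f\<close> is linear, so that it is an isometry iff it preserves
  norms.\<close>

definition admissible_vector ::
  "'a measure \<Rightarrow> 'g measure \<Rightarrow> ('g \<Rightarrow> ('a \<Rightarrow> complex) \<Rightarrow> 'a \<Rightarrow> complex) \<Rightarrow> ('a \<Rightarrow> complex) \<Rightarrow> bool" where
  "admissible_vector M \<mu> \<rho> \<psi> \<longleftrightarrow>
     \<psi> \<in> l2_space M \<and>
     (\<forall>f\<in>l2_space M. voice M \<rho> \<psi> f \<in> l2_space \<mu> \<and> l2_norm \<mu> (voice M \<rho> \<psi> f) = l2_norm M f)"

definition rep_X :: "'d::finite aff \<Rightarrow> (real^'d \<Rightarrow> complex) \<Rightarrow> real^'d \<Rightarrow> complex" where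
  "rep_X g f = (\<lambda>x. complex_of_real (\<bar>det (snd g)\<bar> powr (-1/2)) *
                    f (matrix_inv (snd g) *v (x - fst g)))"

definition rep_\<Xi> ::
  "('d::finite aff \<Rightarrow> 'x \<Rightarrow> 'x) \<Rightarrow> ('d aff \<Rightarrow> real) \<Rightarrow> 'd aff \<Rightarrow> ('x \<Rightarrow> complex) \<Rightarrow> 'x \<Rightarrow> complex" where
  "rep_\<Xi> act \<beta> g F = (\<lambda>\<xi>. complex_of_real (\<beta> g powr (-1/2)) * F (act (sd_inv g) \<xi>))"

definition weight ::
  "('d::finite aff \<Rightarrow> 'x \<Rightarrow> 'x) \<Rightarrow> 'x \<Rightarrow> ('x \<Rightarrow> 'd aff) \<Rightarrow> ('d aff \<Rightarrow> real) \<Rightarrow> ('d aff \<Rightarrow> real) \<Rightarrow>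
   'd aff \<Rightarrow> real" where
  "weight act \<xi>0 \<sigma> \<beta> \<gamma> g =
     \<beta> g powr (-1/2) * \<bar>det (snd g)\<bar> powr (1/2) *
     inverse (\<gamma> (sd_mult g (\<sigma> (act (sd_inv g) \<xi>0))))"


section \<open>The Radon transform\<close>

definition radon ::
  "(real^'d::finite) measure \<Rightarrow> ('x \<Rightarrow> 'd aff) \<Rightarrow> (real^'d \<Rightarrow> complex) \<Rightarrow> 'x \<Rightarrow> complex" where
  "radon m0 \<sigma> f \<xi> = (LINT x|m0. f (sd_act (\<sigma> \<xi>) x))"

definition radon_op ::
  "(real^'d::finite) measure \<Rightarrow> ('x \<Rightarrow> 'd aff) \<Rightarrow> 'x measure \<Rightarrow> (real^'d \<Rightarrow> complex) set \<Rightarrow>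
   (real^'d, 'x) l2_op" where
  "radon_op m0 \<sigma> M\<xi> A = {(f, F). f \<in> A \<and> F \<in> l2_space M\<xi> \<and> l2_eq M\<xi> F (radon m0 \<sigma> f)}"

end

theory Submission
  imports Defs
begin

text \<open>Write \<open>R\<close> for the closed Radon transform.  Everything rests on one identity: for \<open>f\<close> in the
  domain of \<open>R\<close> and \<open>g\<close> in \<open>G\<close>,

  \<open>\<langle>f, \<pi>(g) \<psi>\<rangle> = \<chi>(g) \<langle>R f, \<pi>hat(g) \<Psi>\<rangle>\<close>.

  It expresses the voice transform of \<open>f\<close>, which involves \<open>f\<close> itself, through \<open>R f\<close> alone.  The
  unitarization \<open>Q\<close> preserves scalar products, intertwines \<open>\<pi>\<close> with \<open>\<pi>hat\<close>, and agrees with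
  \<open>I R\<close> on the domain of \<open>R\<close>, so the left-hand side equals \<open>\<langle>I R f, \<pi>hat(g) Q \<psi>\<rangle>\<close>.  By
  semi-invariance \<open>\<pi>hat(g) Q \<psi>\<close> lies in the domain of \<open>I\<close>, which sends it to
  \<open>\<chi>(g) \<pi>hat(g) I Q \<psi> = \<chi>(g) \<pi>hat(g) \<Psi>\<close>; moving the self-adjoint operator \<open>I\<close> across the
  scalar product gives the right-hand side.  This is \<open>voice_eq_weighted_inner\<close>.

  Admissibility of \<open>\<psi>\<close> says that the voice transform is an isometry.  By polarization it preserves
  scalar products as well (\<open>admissible_voice_inner\<close>), which is the weak reconstruction formula
  \<open>\<langle>f, h\<rangle> = \<integral> \<langle>f, \<pi>(g)\<psi>\<rangle> \<langle>\<pi>(g)\<psi>, h\<rangle> d\<mu>(g)\<close>.  Inserting the identity above into this formula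
  and into the norm equality gives both integral formulas.  Finally, \<open>Q \<psi> = I R \<psi>\<close> when \<open>\<psi>\<close> lies in
  the domain of \<open>R\<close>, whence \<open>\<Psi> = I Q \<psi> = I\<^sup>2 R \<psi>\<close>.\<close>


section \<open>Scalar products and norms of square-integrable functions\<close>

lemma l2_space_measurable: "f \<in> l2_space M \<Longrightarrow> f \<in> borel_measurable M"
  by (simp add: l2_space_def)

lemma l2_space_mult_cnj_integrable:
  assumes f: "f \<in> l2_space M" and g: "g \<in> l2_space M"
  shows "integrable M (\<lambda>x. f x * cnj (g x))"
proof (rule Bochner_Integration.integrable_bound)
  show "integrable M (\<lambda>x. (cmod (f x))\<^sup>2 + (cmod (g x))\<^sup>2)"
    using assms by (simp add: l2_space_def)
  show "(\<lambda>x. f x * cnj (g x)) \<in> borel_measurable M"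
    using assms[THEN l2_space_measurable]
    by (intro borel_measurable_times borel_measurable_continuous_on[OF continuous_on_cnj[OF continuous_on_id]])
  have "a * b \<le> a\<^sup>2 + b\<^sup>2" if "0 \<le> a" "0 \<le> b" for a b :: real
    using sum_squares_bound[of a b] mult_nonneg_nonneg[OF that] by linarith
  then show "AE x in M. norm (f x * cnj (g x)) \<le> norm ((cmod (f x))\<^sup>2 + (cmod (g x))\<^sup>2)"
    by (simp add: norm_mult)
qed

lemma cmod_add_mult_square:
  "(cmod (u + a * v))\<^sup>2 = (cmod u)\<^sup>2 + (cmod a)\<^sup>2 * (cmod v)\<^sup>2 + 2 * Re (cnj a * (u * cnj v))"
  unfolding cmod_power2 by (simp add: algebra_simps power2_eq_square)

lemma l2_norm_square: "(l2_norm M f)\<^sup>2 = (LINT x|M. (cmod (f x))\<^sup>2)"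
  by (simp add: l2_norm_def)

lemma l2_cross_term_integral:
  assumes f: "f \<in> l2_space M" and h: "h \<in> l2_space M"
  shows "has_bochner_integral M (\<lambda>x. Re (a * (f x * cnj (h x)))) (Re (a * l2_inner M f h))"
  unfolding l2_inner_def
  by (intro has_bochner_integral_Re has_bochner_integral_mult_right has_bochner_integral_integrable
        l2_space_mult_cnj_integrable f h)

lemma l2_norm_square_integral:
  "f \<in> l2_space M \<Longrightarrow> has_bochner_integral M (\<lambda>x. (cmod (f x))\<^sup>2) ((l2_norm M f)\<^sup>2)"
  by (simp add: l2_space_def has_bochner_integral_iff l2_norm_square)

lemma l2_norm_add_scale_square_integral:
  assumes f: "f \<in> l2_space M" and h: "h \<in> l2_space M"
  shows "has_bochner_integral M (\<lambda>x. (cmod (f x + a * h x))\<^sup>2)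
    ((l2_norm M f)\<^sup>2 + (cmod a)\<^sup>2 * (l2_norm M h)\<^sup>2 + 2 * Re (cnj a * l2_inner M f h))"
  unfolding cmod_add_mult_square
  by (intro has_bochner_integral_add has_bochner_integral_mult_right l2_cross_term_integral
        l2_norm_square_integral f h)

lemma l2_space_add_scale:
  assumes f: "f \<in> l2_space M" and h: "h \<in> l2_space M"
  shows "(\<lambda>x. f x + a * h x) \<in> l2_space M"
proof -
  have "(\<lambda>x. f x + a * h x) \<in> borel_measurable M"
    using assms[THEN l2_space_measurable] by measurable
  then show ?thesis
    using l2_norm_add_scale_square_integral[OF f h]
    by (simp add: l2_space_def has_bochner_integral_iff)
qed

lemma l2_norm_add_scale_square:
  assumes f: "f \<in> l2_space M" and h: "h \<in> l2_space M"
  shows "(l2_norm M (\<lambda>x. f x + a * h x))\<^sup>2 =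
    (l2_norm M f)\<^sup>2 + (cmod a)\<^sup>2 * (l2_norm M h)\<^sup>2 + 2 * Re (cnj a * l2_inner M f h)"
  using l2_norm_add_scale_square_integral[OF f h]
  by (simp add: has_bochner_integral_iff l2_norm_square)

lemma l2_inner_add_scale_left:
  assumes "f \<in> l2_space M" "h \<in> l2_space M" "u \<in> l2_space M"
  shows "l2_inner M (\<lambda>x. f x + a * h x) u = l2_inner M f u + a * l2_inner M h u"
proof -
  have "has_bochner_integral M (\<lambda>x. f x * cnj (u x) + a * (h x * cnj (u x)))
      (l2_inner M f u + a * l2_inner M h u)"
    unfolding l2_inner_def
    by (intro has_bochner_integral_add has_bochner_integral_mult_right has_bochner_integral_integrable
          l2_space_mult_cnj_integrable assms)
  then show ?thesis
    by (simp add: l2_inner_def has_bochner_integral_iff algebra_simps)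
qed

lemma l2_inner_scale_right: "l2_inner M f (\<lambda>x. a * h x) = cnj a * l2_inner M f h"
proof -
  have "l2_inner M f (\<lambda>x. a * h x) = (LINT x|M. cnj a * (f x * cnj (h x)))"
    by (simp add: l2_inner_def algebra_simps)
  then show ?thesis by (simp add: l2_inner_def)
qed

lemma l2_inner_commute: "l2_inner M g f = cnj (l2_inner M f g)"
  unfolding l2_inner_def by (subst Bochner_Integration.integral_cnj[symmetric]) (simp add: mult.commute)

text \<open>Polarization, in the form in which it applies both to unbounded-operator graphs and to the
  voice transform: the norm of \<open>f + a h\<close> determines the real part of \<open>cnj a \<langle>f, h\<rangle>\<close>, and the two
  values \<open>a = 1\<close> and \<open>a = \<i>\<close> recover the real and the imaginary part of \<open>\<langle>f, h\<rangle>\<close>.\<close>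

lemma l2_inner_eq_if_norms_eq:
  assumes l2: "f \<in> l2_space M" "h \<in> l2_space M" "F \<in> l2_space N" "H \<in> l2_space N"
    and eq: "l2_norm N F = l2_norm M f" "l2_norm N H = l2_norm M h"
    and sum_eq: "\<And>a. l2_norm N (\<lambda>y. F y + a * H y) = l2_norm M (\<lambda>x. f x + a * h x)"
  shows "l2_inner N F H = l2_inner M f h"
proof -
  have "Re (cnj a * l2_inner N F H) = Re (cnj a * l2_inner M f h)" for a
    using l2_norm_add_scale_square[OF l2(1,2), of a] l2_norm_add_scale_square[OF l2(3,4), of a]
    by (simp add: eq sum_eq)
  from this[of 1] this[of \<i>] show ?thesis
    by (simp add: complex_eq_iff)
qed


section \<open>Isometries and admissible vectors preserve scalar products\<close>

lemma l2_operator_in_l2_space: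
  "l2_operator M N T \<Longrightarrow> (f, F) \<in> T \<Longrightarrow> f \<in> l2_space M \<and> F \<in> l2_space N"
  unfolding l2_operator_def by blast

lemma l2_operator_single_valued:
  assumes "l2_operator M N T" "(f, F) \<in> T" "(f, F') \<in> T"
  shows "l2_eq N F F'"
proof -
  have "\<forall>(f, F)\<in>T. \<forall>(f', F')\<in>T. l2_eq M f f' \<longrightarrow> l2_eq N F F'"
    using assms(1) unfolding l2_operator_def by (elim conjE)
  from bspec[OF this assms(2)] have "\<forall>(f', F')\<in>T. l2_eq M f f' \<longrightarrow> l2_eq N F F'"
    by simp
  from bspec[OF this assms(3)] show ?thesis
    by (simp add: l2_eq_def)
qed

lemma l2_operator_cong_left:
  assumes T: "l2_operator M N T" and mem: "(f, F) \<in> T"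
    and f': "f' \<in> l2_space M" "l2_eq M f f'"
  shows "(f', F) \<in> T"
proof -
  have "\<forall>(f, F)\<in>T. \<forall>f'\<in>l2_space M. \<forall>F'\<in>l2_space N.
      l2_eq M f f' \<and> l2_eq N F F' \<longrightarrow> (f', F') \<in> T"
    using T unfolding l2_operator_def by (elim conjE)
  from bspec[OF this mem] show ?thesis
    using f' l2_operator_in_l2_space[OF T mem] by (simp add: l2_eq_def)
qed

lemma l2_operator_add_scale:
  assumes T: "l2_operator M N T" and mem: "(f, F) \<in> T" "(h, H) \<in> T"
  shows "(\<lambda>x. f x + a * h x, \<lambda>y. F y + a * H y) \<in> T"
proof -
  have add: "\<forall>(f, F)\<in>T. \<forall>(f', F')\<in>T. (\<lambda>x. f x + f' x, \<lambda>y. F y + F' y) \<in> T"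
    and scale: "\<forall>a. \<forall>(f, F)\<in>T. (\<lambda>x. a * f x, \<lambda>y. a * F y) \<in> T"
    using T unfolding l2_operator_def by - (elim conjE, assumption)+
  have ah: "(\<lambda>x. a * h x, \<lambda>y. a * H y) \<in> T"
    using bspec[OF spec[OF scale] mem(2)] by simp
  have "\<forall>(f', F')\<in>T. (\<lambda>x. f x + f' x, \<lambda>y. F y + F' y) \<in> T"
    using bspec[OF add mem(1)] by simp
  from bspec[OF this ah] show ?thesis by simp
qed

lemma l2_isometry_inner:
  assumes T: "l2_isometry M N T" and mem: "(f, F) \<in> T" "(h, H) \<in> T"
  shows "l2_inner N F H = l2_inner M f h"
proof (rule l2_inner_eq_if_norms_eq)
  have op: "l2_operator M N T" and norm: "\<And>f F. (f, F) \<in> T \<Longrightarrow> l2_norm N F = l2_norm M f"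
    using T by (auto simp: l2_isometry_def)
  show "f \<in> l2_space M" "h \<in> l2_space M" "F \<in> l2_space N" "H \<in> l2_space N"
    using l2_operator_in_l2_space[OF op] mem by auto
  show "l2_norm N F = l2_norm M f" "l2_norm N H = l2_norm M h"
    using norm mem by auto
  show "l2_norm N (\<lambda>y. F y + a * H y) = l2_norm M (\<lambda>x. f x + a * h x)" for a
    by (rule norm[OF l2_operator_add_scale[OF op mem]])
qed

text \<open>The voice transform is linear because each \<open>\<rho> g \<psi>\<close> is square-integrable, so polarization turns
  its norm equality into the orthogonality relation behind the reconstruction formula.\<close>

lemma admissible_voice_inner:
  assumes \<psi>: "admissible_vector M \<mu> \<rho> \<psi>"
    and \<rho>: "\<And>g. g \<in> space \<mu> \<Longrightarrow> \<rho> g \<psi> \<in> l2_space M"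
    and f: "f \<in> l2_space M" and h: "h \<in> l2_space M"
  shows "l2_inner \<mu> (voice M \<rho> \<psi> f) (voice M \<rho> \<psi> h) = l2_inner M f h"
proof (rule l2_inner_eq_if_norms_eq[OF f h])
  have norm: "\<And>f. f \<in> l2_space M \<Longrightarrow> l2_norm \<mu> (voice M \<rho> \<psi> f) = l2_norm M f"
    and mem: "\<And>f. f \<in> l2_space M \<Longrightarrow> voice M \<rho> \<psi> f \<in> l2_space \<mu>"
    using \<psi> by (auto simp: admissible_vector_def)
  show "voice M \<rho> \<psi> f \<in> l2_space \<mu>" "voice M \<rho> \<psi> h \<in> l2_space \<mu>"
    "l2_norm \<mu> (voice M \<rho> \<psi> f) = l2_norm M f" "l2_norm \<mu> (voice M \<rho> \<psi> h) = l2_norm M h"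
    using norm mem f h by auto
  fix a
  have "l2_norm \<mu> (\<lambda>g. voice M \<rho> \<psi> f g + a * voice M \<rho> \<psi> h g) =
      l2_norm \<mu> (voice M \<rho> \<psi> (\<lambda>x. f x + a * h x))"
    unfolding l2_norm_def voice_def
    by (intro arg_cong[where f = sqrt] Bochner_Integration.integral_cong)
       (simp_all add: l2_inner_add_scale_left[OF f h \<rho>])
  also have "\<dots> = l2_norm M (\<lambda>x. f x + a * h x)"
    by (rule norm[OF l2_space_add_scale[OF f h]])
  finally show "l2_norm \<mu> (\<lambda>g. voice M \<rho> \<psi> f g + a * voice M \<rho> \<psi> h g) =
      l2_norm M (\<lambda>x. f x + a * h x)" .
qed

lemma admissible_reconstruction:
  assumes \<psi>: "admissible_vector M \<mu> \<rho> \<psi>"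
    and \<rho>: "\<And>g. g \<in> space \<mu> \<Longrightarrow> \<rho> g \<psi> \<in> l2_space M"
    and f: "f \<in> l2_space M"
  shows "has_weak_integral M \<mu> (voice M \<rho> \<psi> f) (\<lambda>g. \<rho> g \<psi>) f"
  unfolding has_weak_integral_def
proof
  fix h assume h: "h \<in> l2_space M"
  have "integrable \<mu> (\<lambda>g. voice M \<rho> \<psi> f g * cnj (voice M \<rho> \<psi> h g))"
    using \<psi> f h by (intro l2_space_mult_cnj_integrable) (auto simp: admissible_vector_def)
  then have "has_bochner_integral \<mu> (\<lambda>g. voice M \<rho> \<psi> f g * cnj (voice M \<rho> \<psi> h g)) (l2_inner M f h)"
    using admissible_voice_inner[OF \<psi> \<rho> f h]
    by (simp add: has_bochner_integral_iff l2_inner_def)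
  then show "has_bochner_integral \<mu> (\<lambda>g. voice M \<rho> \<psi> f g * l2_inner M (\<rho> g \<psi>) h) (l2_inner M f h)"
    unfolding voice_def l2_inner_commute[of M "\<rho> _ \<psi>" h] .
qed

lemma admissible_norm_square:
  assumes "admissible_vector M \<mu> \<rho> \<psi>" "f \<in> l2_space M"
  shows "has_bochner_integral \<mu> (\<lambda>g. (cmod (voice M \<rho> \<psi> f g))\<^sup>2) ((l2_norm M f)\<^sup>2)"
  using assms l2_norm_square_integral[of "voice M \<rho> \<psi> f" \<mu>]
  by (simp add: admissible_vector_def)


section \<open>The voice transform in terms of the Radon transform\<close>

lemma l2_self_adjoint_inner:
  assumes "l2_self_adjoint N I" "(F, L) \<in> I" "(u, v) \<in> I"
  shows "l2_inner N L u = l2_inner N F v"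
proof -
  have "(u, v) \<in> l2_adjoint N N I"
    using assms by (simp add: l2_self_adjoint_def)
  with assms(2) show ?thesis
    by (auto simp: l2_adjoint_def)
qed

lemma semi_invariant_apply:
  assumes semi: "op_conj a a I = op_scale (complex_of_real (inverse c)) I" and c: "c \<noteq> 0"
    and mem: "(\<phi>, \<Psi>) \<in> I"
  shows "(a \<phi>, \<lambda>y. complex_of_real c * a \<Psi> y) \<in> I"
proof -
  have "(a \<phi>, a \<Psi>) \<in> op_scale (complex_of_real (inverse c)) I"
    unfolding semi[symmetric] op_conj_def using mem by force
  then obtain U where U: "(a \<phi>, U) \<in> I" "a \<Psi> = (\<lambda>y. complex_of_real (inverse c) * U y)"
    by (auto simp: op_scale_def)
  then have "(\<lambda>y. complex_of_real c * a \<Psi> y) = U"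
    using c by (simp flip: mult.assoc of_real_mult)
  with U show ?thesis by simp
qed

text \<open>The identity on which the whole argument rests, for a single group element: \<open>p\<close> and \<open>q\<close> stand
  for \<open>\<pi>(g)\<close> and \<open>\<pi>hat(g)\<close>, and \<open>c\<close> for \<open>\<chi>(g)\<close>.  The hypotheses on \<open>f\<close> and \<open>F\<close> say that
  \<open>I F = Q f\<close>, as is the case for \<open>F = R f\<close>.\<close>

lemma voice_eq_weighted_inner:
  assumes Q: "l2_isometry M N Q" and I: "l2_self_adjoint N I"
    and Q_inv: "op_conj p q Q = Q"
    and I_semi: "op_conj q q I = op_scale (complex_of_real (inverse c)) I" and c: "c \<noteq> 0"
    and f: "(f, L) \<in> Q" "(F, L) \<in> I" and \<psi>: "(\<psi>, \<phi>) \<in> Q" "(\<phi>, \<Psi>) \<in> I"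
  shows "l2_inner M f (p \<psi>) = complex_of_real c * l2_inner N F (q \<Psi>)"
proof -
  have "(p \<psi>, q \<phi>) \<in> op_conj p q Q"
    using \<psi>(1) by (force simp: op_conj_def)
  then have "l2_inner M f (p \<psi>) = l2_inner N L (q \<phi>)"
    using l2_isometry_inner[OF Q f(1)] Q_inv by simp
  also have "\<dots> = l2_inner N F (\<lambda>y. complex_of_real c * q \<Psi> y)"
    by (rule l2_self_adjoint_inner[OF I f(2) semi_invariant_apply[OF I_semi c \<psi>(2)]])
  finally show ?thesis
    by (simp add: l2_inner_scale_right)
qed

text \<open>At the origin the section is trivial, so the argument of \<open>\<gamma>\<close> in the weight is the value of the
  cocycle there, on which \<open>\<gamma>\<close> is positive.\<close>

lemma weight_pos:
  fixes K :: "(real^'d::finite^'d) set"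
  assumes K: "closed_subgroup_GL K" and g: "g \<in> semidirect K" and \<beta>: "0 < \<beta> g"
    and \<sigma>: "\<sigma> \<xi>0 = sd_one" and \<gamma>: "0 < \<gamma> (section_cocycle act \<sigma> g \<xi>0)"
  shows "0 < weight act \<xi>0 \<sigma> \<beta> \<gamma> g"
proof -
  have "matrix_inv (mat 1 :: real^'d^'d) = mat 1"
    unfolding matrix_inv_def by (rule some_equality) simp_all
  then have "section_cocycle act \<sigma> g \<xi>0 = sd_mult g (\<sigma> (act (sd_inv g) \<xi>0))"
    by (simp add: section_cocycle_def \<sigma> sd_mult_def sd_inv_def sd_one_def)
  moreover have "det (snd g) \<noteq> 0"
    using K g by (auto simp: closed_subgroup_GL_def semidirect_def invertible_det_nz)
  ultimately show ?thesis
    using \<beta> \<gamma> by (simp add: weight_def)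
qed

lemma space_sd_haar:
  assumes "left_haar K \<kappa>"
  shows "space (sd_haar \<kappa>) = semidirect K"
proof -
  have "space \<kappa> = K"
    using assms sets_eq_imp_space_eq[of \<kappa> "restrict_space borel K"]
    by (simp add: left_haar_def space_restrict_space)
  then show ?thesis
    by (simp add: sd_haar_def semidirect_def space_pair_measure)
qed


section \<open>Inversion of the Radon transform\<close>

theorem theorem6:
  fixes K :: "(real^'d::finite^'d) set"
    and \<kappa> :: "(real^'d^'d) measure"
    and E :: "'e::euclidean_space set"
    and \<A> :: "('x::{t2_space, second_countable_topology} set \<times> ('x \<Rightarrow> 'e)) set"
    and act :: "'d aff \<Rightarrow> 'x \<Rightarrow> 'x"
    and \<xi>0 :: 'x
    and M\<xi> :: "'x measure"
    and m0 :: "(real^'d) measure"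
    and \<beta> \<gamma> chi :: "'d aff \<Rightarrow> real"
    and \<sigma> :: "'x \<Rightarrow> 'd aff"
    and A :: "(real^'d \<Rightarrow> complex) set"
    and Rbar Q :: "(real^'d, 'x) l2_op"
    and I :: "('x, 'x) l2_op"
    and \<psi> :: "real^'d \<Rightarrow> complex"
    and \<Psi> :: "'x \<Rightarrow> complex"
    and G H :: "'d aff set"
    and \<mu> :: "'d aff measure"
    and X :: "(real^'d) measure"
    and \<pi> :: "'d aff \<Rightarrow> (real^'d \<Rightarrow> complex) \<Rightarrow> real^'d \<Rightarrow> complex"
    and \<pi>hat :: "'d aff \<Rightarrow> ('x \<Rightarrow> complex) \<Rightarrow> 'x \<Rightarrow> complex"
  defines "G \<equiv> semidirect K"
    and "\<mu> \<equiv> sd_haar \<kappa>"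
    and "H \<equiv> isotropy G act \<xi>0"
    and "X \<equiv> lborel"
    and "\<pi> \<equiv> rep_X"
    and "\<pi>hat \<equiv> rep_\<Xi> act \<beta>"
    and "chi \<equiv> weight act \<xi>0 \<sigma> \<beta> \<gamma>"
    and "Rbar \<equiv> l2_op_closure X M\<xi> (radon_op m0 \<sigma> M\<xi> A)"
  assumes K: "closed_subgroup_GL K"
    and haar: "left_haar K \<kappa>"
    and Xi: "smooth_transitive_space G E \<A> act"
    and M\<xi>: "sets M\<xi> = sets borel" "emeasure M\<xi> (space M\<xi>) \<noteq> 0"
    and \<beta>: "rel_invariant M\<xi> G act \<beta>"
    and m0: "radon_on_orbit H m0" "emeasure m0 (space m0) \<noteq> 0"
    and \<gamma>: "rel_invariant m0 H sd_act \<gamma>"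
    and \<sigma>: "borel_section G act \<xi>0 \<sigma>"
    and \<sigma>_indep: "\<And>g \<xi> \<eta>. g \<in> G \<Longrightarrow>
            \<gamma> (section_cocycle act \<sigma> g \<xi>) = \<gamma> (section_cocycle act \<sigma> g \<eta>)"
    and \<sigma>_char: "\<And>\<xi>. pos_character G (\<lambda>g. \<gamma> (section_cocycle act \<sigma> g \<xi>))"
    and dual: "dual_pair K act \<xi>0 \<sigma>"
    and \<pi>_irr: "irreducible_rep X G \<pi>"
    and \<pi>_sqi: "square_integrable_rep X \<mu> \<pi>"
    and \<pi>hat_irr: "irreducible_rep M\<xi> G \<pi>hat"
    and A: "l2_subspace X A" "\<exists>f\<in>A. \<not> l2_eq X f (\<lambda>_. 0)"
    and A_inv: "\<And>g f. g \<in> G \<Longrightarrow> f \<in> A \<Longrightarrow> \<pi> g f \<in> A"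
    and A_int: "\<And>f. f \<in> A \<Longrightarrow> AE \<xi> in M\<xi>. integrable m0 (\<lambda>x. f (sd_act (\<sigma> \<xi>) x))"
    and A_L2: "\<And>f. f \<in> A \<Longrightarrow> radon m0 \<sigma> f \<in> l2_space M\<xi>"
    and A_closable: "l2_closable X M\<xi> (radon_op m0 \<sigma> M\<xi> A)"
    and I: "l2_self_adjoint M\<xi> I" "l2_positive M\<xi> I"
    and I_dom: "Range Rbar \<subseteq> Domain I"
    and I_semi: "\<And>g. g \<in> G \<Longrightarrow>
            op_conj (\<pi>hat g) (\<pi>hat g) I = op_scale (complex_of_real (inverse (chi g))) I"
    and Q: "l2_isometry X M\<xi> Q"
    and Q_ext: "Rbar O I \<subseteq> Q"
    and Q_inv: "\<And>g. g \<in> G \<Longrightarrow> op_conj (\<pi> g) (\<pi>hat g) Q = Q"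
    and \<psi>: "admissible_vector X \<mu> \<pi> \<psi>"
    and \<Psi>: "(\<psi>, \<Psi>) \<in> Q O I"
  shows "(\<forall>(f, F)\<in>Rbar.
            has_weak_integral X \<mu>
              (\<lambda>g. complex_of_real (chi g) * l2_inner M\<xi> F (\<pi>hat g \<Psi>)) (\<lambda>g. \<pi> g \<psi>) f \<and>
            has_bochner_integral \<mu>
              (\<lambda>g. (chi g)\<^sup>2 * (cmod (l2_inner M\<xi> F (\<pi>hat g \<Psi>)))\<^sup>2) ((l2_norm X f)\<^sup>2)) \<and>
         (\<psi> \<in> Domain Rbar \<longrightarrow> (\<forall>F. (\<psi>, F) \<in> Rbar \<longrightarrow> (F, \<Psi>) \<in> I O I))"
proof -
  have space: "space \<mu> = G"
    unfolding \<mu>_def G_def by (rule space_sd_haar[OF haar])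
  have chi: "chi g \<noteq> 0" if "g \<in> G" for g
  proof -
    have "0 < weight act \<xi>0 \<sigma> \<beta> \<gamma> g"
      using that \<beta> \<sigma> \<sigma>_char[of \<xi>0] K
      by (intro weight_pos[of K])
         (auto simp: G_def rel_invariant_def pos_character_def borel_section_def)
    then show ?thesis by (simp add: chi_def)
  qed
  obtain \<phi> where \<phi>: "(\<psi>, \<phi>) \<in> Q" "(\<phi>, \<Psi>) \<in> I"
    using \<Psi> by blast
  have Q_op: "l2_operator X M\<xi> Q"
    using Q by (simp add: l2_isometry_def)
  have I_op: "l2_operator M\<xi> M\<xi> I"
    using I(1) by (simp add: l2_self_adjoint_def)
  have \<pi>\<psi>: "\<pi> g \<psi> \<in> l2_space X" if "g \<in> space \<mu>" for g
  proof -
    \<comment> \<open>The graph of \<open>Q\<close> consists of pairs of square-integrable functions and is mapped to itself by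
      \<open>(\<pi> g, \<pi>hat g)\<close>, so no change of variables is needed.\<close>
    have "(\<pi> g \<psi>, \<pi>hat g \<phi>) \<in> op_conj (\<pi> g) (\<pi>hat g) Q"
      using \<phi>(1) by (force simp: op_conj_def)
    then show ?thesis
      using l2_operator_in_l2_space[OF Q_op] Q_inv that space by auto
  qed
  have Q_R: "\<exists>L. (f, L) \<in> Q \<and> (F, L) \<in> I" if fF: "(f, F) \<in> Rbar" for f F
  proof -
    obtain L where "(F, L) \<in> I"
      using fF I_dom by blast
    then show ?thesis
      using fF Q_ext by blast
  qed
  have "has_weak_integral X \<mu>
          (\<lambda>g. complex_of_real (chi g) * l2_inner M\<xi> F (\<pi>hat g \<Psi>)) (\<lambda>g. \<pi> g \<psi>) f \<and>
        has_bochner_integral \<mu>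
          (\<lambda>g. (chi g)\<^sup>2 * (cmod (l2_inner M\<xi> F (\<pi>hat g \<Psi>)))\<^sup>2) ((l2_norm X f)\<^sup>2)"
    if fF: "(f, F) \<in> Rbar" for f F
  proof -
    obtain L where L: "(f, L) \<in> Q" "(F, L) \<in> I"
      using Q_R[OF fF] by blast
    have f: "f \<in> l2_space X"
      using l2_operator_in_l2_space[OF Q_op L(1)] by simp
    have voice: "voice X \<pi> \<psi> f g = complex_of_real (chi g) * l2_inner M\<xi> F (\<pi>hat g \<Psi>)"
      if "g \<in> space \<mu>" for g
      using that voice_eq_weighted_inner[OF Q I(1) Q_inv I_semi chi L \<phi>]
      by (simp add: voice_def space)
    have "has_weak_integral X \<mu>
        (\<lambda>g. complex_of_real (chi g) * l2_inner M\<xi> F (\<pi>hat g \<Psi>)) (\<lambda>g. \<pi> g \<psi>) f"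
      using admissible_reconstruction[OF \<psi> \<pi>\<psi> f]
      unfolding has_weak_integral_def
      by (simp add: voice cong: has_bochner_integral_cong)
    moreover have "has_bochner_integral \<mu>
        (\<lambda>g. (chi g)\<^sup>2 * (cmod (l2_inner M\<xi> F (\<pi>hat g \<Psi>)))\<^sup>2) ((l2_norm X f)\<^sup>2)"
      using admissible_norm_square[OF \<psi> f]
      by (simp add: voice norm_mult power_mult_distrib cong: has_bochner_integral_cong)
    ultimately show ?thesis ..
  qed
  moreover have "(F, \<Psi>) \<in> I O I" if F: "(\<psi>, F) \<in> Rbar" for F
  proof -
    \<comment> \<open>\<open>Q \<psi>\<close> is represented both by \<open>\<phi>\<close> and by \<open>L = I R \<psi>\<close>; the graph of \<open>I\<close> does not distinguish them.\<close>
    obtain L where L: "(\<psi>, L) \<in> Q" "(F, L) \<in> I"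
      using Q_R[OF F] by blast
    have "l2_eq M\<xi> \<phi> L"
      by (rule l2_operator_single_valued[OF Q_op \<phi>(1) L(1)])
    moreover have "L \<in> l2_space M\<xi>"
      using l2_operator_in_l2_space[OF Q_op L(1)] by simp
    ultimately have "(L, \<Psi>) \<in> I"
      using l2_operator_cong_left[OF I_op \<phi>(2)] by blast
    with L(2) show ?thesis by blast
  qed
  ultimately show ?thesis by blast
qed

end
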